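(* Let $G$ be a finite $p$-group of order $n$. Then $\kappa(\mathcal{G}(G)) = \lambda_{n-1}(\mathcal{G}(G))$ if and only if $G$ is not cyclic.
   Context: $p$ is a prime; a $p$-group is a group of order at least two in which every element has order a power of $p$. The power graph $\mathcal{G}(G)$ has vertex set $G$, distinct $u,v$ adjacent iff one is a positive power of the other. $\kappa(\Gamma)$ is the vertex connectivity (minimum number of vertices whose removal leaves a disconnected or one-vertex graph). $\lambda_{n-1}(\Gamma)$ is the second smallest eigenvalue of the Laplacian $L(\Gamma)=D(\Gamma)-A(\Gamma)$ of a graph on $n$ vertices. *)

theory Defs
  imports
    "HOL-Algebra.Elementary_Groups"
    "HOL-Algebra.Multiplicative_Group"
    "Graph_Theory.Digraph_Component"
    "Jordan_Normal_Form.Char_Poly"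
begin

text \<open>
  \<^const>\<open>group.ord\<close> is \<open>0\<close> on elements of infinite order, so for prime \<open>p\<close> the last condition excludes
  such elements. The condition on the carrier says that the group has order at least two.
\<close>
definition p_group :: "nat \<Rightarrow> ('a, 'b) monoid_scheme \<Rightarrow> bool" where
  "p_group p G \<longleftrightarrow> group G \<and> carrier G \<noteq> {\<one>\<^bsub>G\<^esub>} \<and> (\<forall>x\<in>carrier G. \<exists>k. group.ord G x = p ^ k)"

text \<open>
  Simple graphs are represented as loop-free digraphs with a symmetric set of arcs (\<^locale>\<open>pair_graph\<close>).
\<close>
definition power_graph :: "('a, 'b) monoid_scheme \<Rightarrow> 'a pair_pre_digraph" where
  "power_graph G = \<lparr> pverts = carrier G,
     parcs = {(u, v). u \<in> carrier G \<and> v \<in> carrier G \<and> u \<noteq> v \<and>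
       (\<exists>m::nat. 0 < m \<and> (u = v [^]\<^bsub>G\<^esub> m \<or> v = u [^]\<^bsub>G\<^esub> m))} \<rparr>"

text \<open>
  Only for finite nonempty graphs. At least one vertex has to remain, so the convention that the
  graph without vertices is not \<^const>\<open>connected\<close> plays no role.
\<close>
definition vertex_connectivity :: "'a pair_pre_digraph \<Rightarrow> nat" where
  "vertex_connectivity \<Gamma> = (LEAST k. \<exists>S. S \<subset> pverts \<Gamma> \<and> card S = k \<and>
     (\<not> connected (with_proj \<Gamma> \<restriction> (pverts \<Gamma> - S)) \<or> card (pverts \<Gamma> - S) = 1))"

text \<open>
  Rows and columns of the matrices are indexed by the positions in a list \<open>vs\<close> that enumerates the
  vertices without repetition.
\<close>
definition degree_mat :: "'a pair_pre_digraph \<Rightarrow> 'a list \<Rightarrow> real mat" where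
  "degree_mat \<Gamma> vs = mat (length vs) (length vs)
     (\<lambda>(i, j). if i = j then real (out_degree (with_proj \<Gamma>) (vs ! i)) else 0)"

definition adjacency_mat :: "'a pair_pre_digraph \<Rightarrow> 'a list \<Rightarrow> real mat" where
  "adjacency_mat \<Gamma> vs = mat (length vs) (length vs)
     (\<lambda>(i, j). if (vs ! i, vs ! j) \<in> parcs \<Gamma> then 1 else 0)"

definition laplacian_mat :: "'a pair_pre_digraph \<Rightarrow> 'a list \<Rightarrow> real mat" where
  "laplacian_mat \<Gamma> vs = degree_mat \<Gamma> vs - adjacency_mat \<Gamma> vs"

text \<open>
  The eigenvalues with multiplicity, in ascending order. The enumeration of the vertices is arbitrary:
  another one conjugates the matrix by a permutation matrix and gives the same characteristic
  polynomial. All roots of this polynomial are real since the matrix is symmetric.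
\<close>
definition laplacian_spectrum :: "'a pair_pre_digraph \<Rightarrow> real list" where
  "laplacian_spectrum \<Gamma> = sorted_list_of_multiset (proots (char_poly
     (laplacian_mat \<Gamma> (SOME vs. distinct vs \<and> set vs = pverts \<Gamma>))))"

text \<open>
  The eigenvalues are numbered from \<open>1\<close> in descending order: \<open>k = card (pverts \<Gamma>)\<close> gives the
  smallest one and \<open>k = card (pverts \<Gamma>) - 1\<close> the second smallest one.
\<close>
definition laplacian_eigenvalue :: "nat \<Rightarrow> 'a pair_pre_digraph \<Rightarrow> real" where
  "laplacian_eigenvalue k \<Gamma> = laplacian_spectrum \<Gamma> ! (card (pverts \<Gamma>) - k)"

end

theory Submission
  imports Defs
begin

text \<open>
  The power graph of a cyclic \<open>p\<close>-group is complete, so its vertex connectivity is \<open>n - 1\<close> while all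
  nonzero Laplacian eigenvalues are \<open>n\<close>. For a noncyclic \<open>p\<close>-group let \<open>k + 1\<close> be the least exponent such
  that there are several cyclic subgroups of order \<open>p ^ (k + 1)\<close>, and let \<open>C\<close> be the only one of order
  \<open>p ^ k\<close>. Then every element of \<open>C\<close> is adjacent to all other vertices, and the graph without \<open>C\<close> is
  disconnected: the vertex connectivity is \<open>card C\<close>. A Laplacian eigenfunction for a nonzero
  eigenvalue \<open>\<mu> \<noteq> n\<close> vanishes on \<open>C\<close>, and looking at its maximum gives \<open>\<mu> \<ge> card C\<close>; a function
  that is constant on each side of the disconnection shows that \<open>card C\<close> is an eigenvalue.
\<close>


subsection \<open>Second smallest Laplacian eigenvalue\<close>

text \<open>The spectrum counts roots with algebraic multiplicity, so 0 has to be a simple root of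
  the polynomial itself. Vanishing column sums split off the factor \<open>[:0, 1:]\<close>; the
  cofactor could vanish at 0 only if \<open>L\<close> had a nonzero kernel vector of sum 0.\<close>

lemma char_poly_simple_root_0:
  fixes L :: "real mat"
  assumes L: "L \<in> carrier_mat n n" and n: "0 < n"
    and col: "\<And>j. j < n \<Longrightarrow> (\<Sum>i<n. L $$ (i, j)) = 0"
    and ker: "\<And>v. \<lbrakk>v \<in> carrier_vec n; L *\<^sub>v v = 0\<^sub>v n; (\<Sum>i<n. v $ i) = 0\<rbrakk> \<Longrightarrow> v = 0\<^sub>v n"
  obtains q where "char_poly L = [:0, 1:] * q" "poly q 0 \<noteq> 0"
proof
  \<comment> \<open>Left multiplication by \<open>E\<close> adds all rows to the first one, which becomes constant \<open>[:0, 1:]\<close>.\<close>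
  define E :: "real poly mat" where "E = mat n n (\<lambda>(i, j). if i = 0 \<or> i = j then 1 else 0)"
  define M where "M = mat n n (\<lambda>(i, j). if i = 0 then 1 else char_poly_matrix L $$ (i, j))"
  have E: "E \<in> carrier_mat n n" and M: "M \<in> carrier_mat n n" by (auto simp: E_def M_def)
  have P: "char_poly_matrix L \<in> carrier_mat n n" using L by simp
  have P_index: "char_poly_matrix L $$ (i, j) = (if i = j then [:0, 1:] else 0) + [:- L $$ (i, j):]"
    if "i < n" "j < n" for i j using L that by (auto simp: char_poly_matrix_def)
  have "det E = prod_list (diag_mat E)"
    by (rule det_upper_triangular[OF _ E]) (auto simp: E_def)
  also have "\<dots> = 1"
    using E by (auto simp: diag_mat_def E_def intro!: prod_list_neutral)
  finally have detE: "det E = 1" .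
  have "E * char_poly_matrix L = multrow 0 [:0, 1:] M"
  proof (rule eq_matI)
    fix i j assume "i < dim_row (multrow 0 [:0, 1:] M)" "j < dim_col (multrow 0 [:0, 1:] M)"
    then have ij: "i < n" "j < n" using M by auto
    have *: "(E * char_poly_matrix L) $$ (i, j) =
        (\<Sum>k<n. (if i = 0 \<or> i = k then char_poly_matrix L $$ (k, j) else 0))"
      using ij E P by (auto simp: scalar_prod_def E_def atLeast0LessThan intro!: sum.cong)
    show "(E * char_poly_matrix L) $$ (i, j) = multrow 0 [:0, 1:] M $$ (i, j)"
    proof (cases "i = 0")
      case True
      have "(\<Sum>k<n. char_poly_matrix L $$ (k, j)) =
          (\<Sum>k<n. (if k = j then [:0, 1:] else 0)) + (\<Sum>k<n. [:- L $$ (k, j):])"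
        using ij by (simp add: P_index sum.distrib)
      also have "(\<Sum>k<n. [:- L $$ (k, j):]) = [:- (\<Sum>k<n. L $$ (k, j)):]"
        by (induction n) simp_all
      finally have "(\<Sum>k<n. char_poly_matrix L $$ (k, j)) = [:0, 1:]"
        using ij col by simp
      then show ?thesis using * True ij M by (simp add: M_def)
    next
      case False
      then show ?thesis using * ij M by (simp add: M_def)
    qed
  qed (use E P M in auto)
  then have "det E * char_poly L = [:0, 1:] * det M"
    using det_mult[OF E P] det_multrow[OF n M] by (simp add: char_poly_def)
  then show "char_poly L = [:0, 1:] * det M" using detE by simp
  \<comment> \<open>\<open>M\<close> evaluated at 0: the matrix \<open>- L\<close> with its first
    row replaced by ones.\<close>
  define M0 where "M0 = mat n n (\<lambda>(i, j). if i = 0 then 1 else - L $$ (i, j))"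
  have M0: "M0 \<in> carrier_mat n n" by (simp add: M0_def)
  have "poly (det M) 0 = det M0"
    by (rule poly_det_cong[OF M0 M]) (auto simp: M_def M0_def P_index)
  moreover have "det M0 \<noteq> 0"
  proof
    assume "det M0 = 0"
    then obtain v where v: "v \<in> carrier_vec n" "v \<noteq> 0\<^sub>v n" and M0v: "M0 *\<^sub>v v = 0\<^sub>v n"
      using det_0_iff_vec_prod_zero[OF M0] by blast
    have index: "(M0 *\<^sub>v v) $ i = (if i = 0 then \<Sum>j<n. v $ j else - (L *\<^sub>v v) $ i)" if "i < n" for i
      using that v L
      by (auto simp: M0_def scalar_prod_def atLeast0LessThan sum_negf[symmetric] intro!: sum.cong)
    have sum0: "(\<Sum>j<n. v $ j) = 0" using index[OF n] M0v n by simp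
    have Lv: "(L *\<^sub>v v) $ i = 0" if "i < n" "i \<noteq> 0" for i using index[of i] M0v that by simp
    \<comment> \<open>\<open>M0\<close> has lost row 0 of \<open>L\<close>; the column sums recover
      the missing entry of the product.\<close>
    have "(\<Sum>i<n. (L *\<^sub>v v) $ i) = (\<Sum>i<n. \<Sum>j<n. L $$ (i, j) * v $ j)"
      using v L by (simp add: scalar_prod_def atLeast0LessThan)
    also have "\<dots> = (\<Sum>j<n. (\<Sum>i<n. L $$ (i, j)) * v $ j)"
      by (subst sum.swap) (simp add: sum_distrib_right)
    also have "\<dots> = 0" using col by simp
    finally have "(\<Sum>i<n. (L *\<^sub>v v) $ i) = 0" .
    moreover have "(\<Sum>i<n. (L *\<^sub>v v) $ i) = (L *\<^sub>v v) $ 0"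
      using n Lv by (subst sum.remove[of _ 0]) auto
    ultimately have "(L *\<^sub>v v) $ i = 0" if "i < n" for i using Lv that by (cases "i = 0") auto
    then have "L *\<^sub>v v = 0\<^sub>v n" using L by (intro eq_vecI) auto
    then show False using ker sum0 v by blast
  qed
  ultimately show "poly (det M) 0 \<noteq> 0" by simp
qed

text \<open>The sorted roots of \<open>q\<close> start with \<open>c\<close>, and
  \<open>insort\<close> puts the single 0 in front of them, so \<open>c\<close> lands at index
  1.\<close>

lemma second_of_sorted_roots:
  fixes P :: "real poly"
  assumes P: "P = [:0, 1:] * q" "poly q 0 \<noteq> 0"
    and c: "poly P c = 0" "0 < c" and least: "\<And>x. \<lbrakk>poly P x = 0; x \<noteq> 0\<rbrakk> \<Longrightarrow> c \<le> x"
  shows "sorted_list_of_multiset (proots P) ! 1 = c"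
proof -
  have q0: "q \<noteq> 0" using P(2) by auto
  define xs where "xs = sorted_list_of_multiset (proots q)"
  have set: "set xs = {x. poly q x = 0}" using q0 by (simp add: xs_def)
  have ge: "c \<le> x" if "x \<in> set xs" for x
    using least[of x] that P by (auto simp: set)
  have "c \<in> set xs" using c P by (auto simp: set)
  moreover have "sorted xs" by (simp add: xs_def)
  ultimately obtain ys where ys: "xs = c # ys"
    using ge by (cases xs) (auto simp: order_antisym)
  have "proots P = add_mset 0 (proots q)"
    using q0 unfolding P(1) by (subst proots_mult) auto
  then have "sorted_list_of_multiset (proots P) = insort 0 xs" by (simp add: xs_def)
  then show ?thesis using c(2) by (simp add: ys)
qed

section \<open>The Laplacian as an operator on functions of the vertices\<close>

text \<open>Needs no enumeration of the vertices, so eigenvectors can be treated as functions on the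
  graph.\<close>

definition laplacian_op :: "'a pair_pre_digraph \<Rightarrow> ('a \<Rightarrow> real) \<Rightarrow> 'a \<Rightarrow> real" where
  "laplacian_op \<Gamma> f x = (\<Sum>y | (x, y) \<in> parcs \<Gamma>. f x - f y)"

context pair_graph
begin

lemma finite_neighbours: "finite {y. (x, y) \<in> parcs G}"
  by (rule finite_subset[OF _ pair_finite_verts]) (auto dest: in_arcsD2)

lemma laplacian_op_alt:
  "laplacian_op G f x = (\<Sum>y\<in>pverts G. if (x, y) \<in> parcs G then f x - f y else 0)"
proof -
  have "{y \<in> pverts G. (x, y) \<in> parcs G} = {y. (x, y) \<in> parcs G}" by (auto dest: in_arcsD2)
  then show ?thesis
    unfolding laplacian_op_def by (simp add: sum.If_cases pair_finite_verts Int_def)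
qed

lemma arcs_commute: "(x, y) \<in> parcs G \<longleftrightarrow> (y, x) \<in> parcs G"
  using pair_sym_arcs by (auto simp: symmetric_def sym_def)

text \<open>The two ends of an edge contribute opposite terms, so exchanging the sums gives
  \<open>?S = - ?S\<close>. Hence eigenfunctions for nonzero eigenvalues sum to 0.\<close>

lemma sum_laplacian_op: "(\<Sum>x\<in>pverts G. laplacian_op G f x) = 0"
proof -
  let ?S = "\<Sum>x\<in>pverts G. laplacian_op G f x"
  have "?S = (\<Sum>y\<in>pverts G. \<Sum>x\<in>pverts G. if (x, y) \<in> parcs G then f x - f y else 0)"
    unfolding laplacian_op_alt by (rule sum.swap)
  also have "\<dots> = (\<Sum>y\<in>pverts G. - laplacian_op G f y)"
    unfolding laplacian_op_alt sum_negf[symmetric]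
    by (intro sum.cong) (auto simp: arcs_commute)
  finally show ?thesis by (simp add: sum_negf)
qed

lemma out_degree_eq_card_neighbours: "out_degree (with_proj G) x = card {y. (x, y) \<in> parcs G}"
proof -
  have "out_arcs (with_proj G) x = Pair x ` {y. (x, y) \<in> parcs G}" by (auto simp: out_arcs_def)
  then show ?thesis by (simp add: out_degree_def card_image inj_on_def)
qed

context
  fixes vs
  assumes vs: "distinct vs" "set vs = pverts G"
begin

lemma laplacian_mat_carrier: "laplacian_mat G vs \<in> carrier_mat (length vs) (length vs)"
  by (auto simp: laplacian_mat_def degree_mat_def adjacency_mat_def intro!: minus_carrier_mat)

lemma laplacian_mat_symmetric:
  "\<lbrakk>i < length vs; j < length vs\<rbrakk> \<Longrightarrow> laplacian_mat G vs $$ (i, j) = laplacian_mat G vs $$ (j, i)"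
  by (auto simp: laplacian_mat_def degree_mat_def adjacency_mat_def arcs_commute)

lemma sum_over_list: "(\<Sum>i<length vs. h (vs ! i)) = (\<Sum>x\<in>pverts G. h x)"
  using sum.reindex_bij_betw[OF bij_betw_nth[OF vs(1) refl refl], of h] vs(2) by simp

lemma laplacian_mat_mult_vec:
  assumes i: "i < length vs"
  shows "(laplacian_mat G vs *\<^sub>v vec (length vs) (\<lambda>i. f (vs ! i))) $ i = laplacian_op G f (vs ! i)"
proof -
  let ?x = "vs ! i"
  have nb: "{y \<in> pverts G. (?x, y) \<in> parcs G} = {y. (?x, y) \<in> parcs G}" by (auto dest: in_arcsD2)
  have "(laplacian_mat G vs *\<^sub>v vec (length vs) (\<lambda>i. f (vs ! i))) $ i =
      (\<Sum>j<length vs. (if i = j then real (out_degree (with_proj G) ?x) * f ?x else 0) -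
        (if (?x, vs ! j) \<in> parcs G then f (vs ! j) else 0))"
    using i by (auto simp: laplacian_mat_def degree_mat_def adjacency_mat_def scalar_prod_def
        atLeast0LessThan algebra_simps intro!: sum.cong)
  also have "\<dots> = real (out_degree (with_proj G) ?x) * f ?x -
      (\<Sum>y\<in>pverts G. if (?x, y) \<in> parcs G then f y else 0)"
    using i by (simp add: sum_subtractf flip: sum_over_list)
  also have "\<dots> = laplacian_op G f ?x"
    by (simp add: sum.If_cases pair_finite_verts Int_def nb laplacian_op_def sum_subtractf
        out_degree_eq_card_neighbours)
  finally show ?thesis .
qed

lemma vec_eq_function_values:
  assumes "v \<in> carrier_vec (length vs)"
  obtains f where "v = vec (length vs) (\<lambda>i. f (vs ! i))"
proof
  show "v = vec (length vs) (\<lambda>i. v $ (THE j. j < length vs \<and> vs ! j = vs ! i))" (is "v = vec _ (\<lambda>i. ?f (vs ! i))")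
  proof (rule eq_vecI)
    fix i assume "i < dim_vec (vec (length vs) (\<lambda>i. ?f (vs ! i)))"
    then have "(THE j. j < length vs \<and> vs ! j = vs ! i) = i"
      using vs(1) by (auto simp: nth_eq_iff_index_eq)
    then show "v $ i = vec (length vs) (\<lambda>i. ?f (vs ! i)) $ i" using assms \<open>i < _\<close> by simp
  qed (use assms in auto)
qed

lemma laplacian_mat_eq_iff:
  "laplacian_mat G vs *\<^sub>v vec (length vs) (\<lambda>i. f (vs ! i)) = c \<cdot>\<^sub>v vec (length vs) (\<lambda>i. f (vs ! i))
    \<longleftrightarrow> (\<forall>x\<in>pverts G. laplacian_op G f x = c * f x)" (is "?L = ?R \<longleftrightarrow> _")
proof -
  have "?L = ?R \<longleftrightarrow> (\<forall>i<length vs. ?L $ i = ?R $ i)"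
    using laplacian_mat_carrier by (auto simp: vec_eq_iff)
  also have "\<dots> \<longleftrightarrow> (\<forall>i<length vs. laplacian_op G f (vs ! i) = c * f (vs ! i))"
    by (simp add: laplacian_mat_mult_vec)
  also have "\<dots> \<longleftrightarrow> (\<forall>x\<in>set vs. laplacian_op G f x = c * f x)"
    by (simp add: all_set_conv_all_nth)
  finally show ?thesis by (simp add: vs(2))
qed

lemma vec_eq_0_iff:
  "vec (length vs) (\<lambda>i. f (vs ! i)) = 0\<^sub>v (length vs) \<longleftrightarrow> (\<forall>x\<in>pverts G. f x = 0)"
  by (simp add: vec_eq_iff all_set_conv_all_nth flip: vs(2))

lemma root_char_poly_laplacian_mat_iff:
  "poly (char_poly (laplacian_mat G vs)) c = 0 \<longleftrightarrow>
    (\<exists>f. (\<exists>x\<in>pverts G. f x \<noteq> 0) \<and> (\<forall>x\<in>pverts G. laplacian_op G f x = c * f x))"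
proof -
  have dim: "dim_row (laplacian_mat G vs) = length vs" using laplacian_mat_carrier by simp
  have "(\<exists>v. eigenvector (laplacian_mat G vs) v c) \<longleftrightarrow>
      (\<exists>f. eigenvector (laplacian_mat G vs) (vec (length vs) (\<lambda>i. f (vs ! i))) c)"
    unfolding eigenvector_def dim using vec_eq_function_values by metis
  also have "\<dots> \<longleftrightarrow> (\<exists>f. (\<exists>x\<in>pverts G. f x \<noteq> 0) \<and> (\<forall>x\<in>pverts G. laplacian_op G f x = c * f x))"
    unfolding eigenvector_def dim laplacian_mat_eq_iff vec_eq_0_iff by simp
  finally show ?thesis
    unfolding eigenvalue_root_char_poly[OF laplacian_mat_carrier, symmetric] eigenvalue_def .
qed

text \<open>By symmetry this is a row sum, that is, an entry of the matrix applied to the constant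
  function 1, which the Laplacian kills.\<close>

lemma sum_column_laplacian_mat:
  assumes j: "j < length vs"
  shows "(\<Sum>i<length vs. laplacian_mat G vs $$ (i, j)) = 0"
proof -
  have "(\<Sum>i<length vs. laplacian_mat G vs $$ (i, j)) = (\<Sum>i<length vs. laplacian_mat G vs $$ (j, i))"
    using j laplacian_mat_symmetric by (intro sum.cong) auto
  also have "\<dots> = (laplacian_mat G vs *\<^sub>v vec (length vs) (\<lambda>i. 1)) $ j"
    using j laplacian_mat_carrier by (simp add: scalar_prod_def atLeast0LessThan)
  also have "\<dots> = 0"
    using laplacian_mat_mult_vec[OF j, of "\<lambda>_. 1"] by (simp add: laplacian_op_def)
  finally show ?thesis .
qed

end

section \<open>Eigenvalues of graphs with dominating vertices\<close>

text \<open>The sum over the neighbours of \<open>d\<close> may run over all vertices, since the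
  term at \<open>d\<close> itself is 0.\<close>

lemma laplacian_op_dominating:
  fixes f :: "'a \<Rightarrow> real"
  assumes "d \<in> pverts G" "\<And>v. \<lbrakk>v \<in> pverts G; d \<noteq> v\<rbrakk> \<Longrightarrow> (d, v) \<in> parcs G"
  shows "laplacian_op G f d = real (card (pverts G)) * f d - (\<Sum>x\<in>pverts G. f x)"
proof -
  have "laplacian_op G f d = (\<Sum>y\<in>pverts G. f d - f y)"
    unfolding laplacian_op_alt by (intro sum.cong) (use assms in auto)
  then show ?thesis by (simp add: sum_subtractf)
qed

text \<open>If \<open>f\<close> is nonzero somewhere on \<open>D\<close>, then \<open>c\<close> is
  the number of vertices. Otherwise take a maximum point \<open>x\<close>, where \<open>f x\<close>
  is positive: no term \<open>f x - f y\<close> is negative, and those with \<open>y\<close> in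
  \<open>D\<close> equal \<open>f x\<close>. The value \<open>c = 0\<close> is allowed.\<close>

lemma card_dominating_le_eigenvalue:
  fixes f :: "'a \<Rightarrow> real" and c :: real
  assumes D: "D \<subseteq> pverts G" "\<And>d v. \<lbrakk>d \<in> D; v \<in> pverts G; d \<noteq> v\<rbrakk> \<Longrightarrow> (d, v) \<in> parcs G"
    and sum0: "(\<Sum>x\<in>pverts G. f x) = 0" and nz: "\<exists>x\<in>pverts G. f x \<noteq> 0"
    and eigen: "\<And>x. x \<in> pverts G \<Longrightarrow> laplacian_op G f x = c * f x"
  shows "card D \<le> c"
proof (cases "\<exists>d\<in>D. f d \<noteq> 0")
  case True
  then obtain d where d: "d \<in> D" "f d \<noteq> 0" by blast
  have "card (pverts G) * f d = c * f d"
    using laplacian_op_dominating[of d f] D d eigen[of d] sum0 by auto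
  then show ?thesis using d D card_mono[OF pair_finite_verts] by auto
next
  case False
  have "\<exists>x\<in>pverts G. 0 < f x"
  proof (rule ccontr)
    assume "\<not> ?thesis"
    then have "\<forall>x\<in>pverts G. - f x = 0"
      using sum0 by (subst sum_nonneg_eq_0_iff[symmetric]) (auto simp: pair_finite_verts sum_negf not_less)
    then show False using nz by simp
  qed
  moreover have "Max (f ` pverts G) \<in> f ` pverts G" using nz pair_finite_verts by (intro Max_in) auto
  then obtain x where x: "x \<in> pverts G" and max: "\<And>y. y \<in> pverts G \<Longrightarrow> f y \<le> f x"
    using pair_finite_verts by (metis Max_ge finite_imageI imageE imageI)
  ultimately have pos: "0 < f x" by (meson less_le_trans)
  have DV: "D \<subseteq> {y. (x, y) \<in> parcs G}"
  proof
    fix d assume d: "d \<in> D"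
    then have "d \<noteq> x" using False pos by auto
    then show "d \<in> {y. (x, y) \<in> parcs G}" using D(2)[OF d x] arcs_commute by blast
  qed
  have "card D * f x = (\<Sum>y\<in>D. f x - f y)" using False by simp
  also have "\<dots> \<le> laplacian_op G f x"
    unfolding laplacian_op_def
    by (rule sum_mono2[OF finite_neighbours DV]) (use max in \<open>auto dest: in_arcsD2\<close>)
  also have "\<dots> = c * f x" using eigen x by simp
  finally show ?thesis using pos by simp
qed

text \<open>The bound on eigenvalues is used twice: for eigenvalue 0 it makes 0 a simple root, and
  for the others it makes \<open>card D\<close>, with eigenfunction \<open>g\<close>, the least
  nonzero root.\<close>

lemma second_laplacian_eigenvalue_eq_card_dominating:
  fixes g :: "'a \<Rightarrow> real"
  assumes D: "D \<subseteq> pverts G" "\<And>d v. \<lbrakk>d \<in> D; v \<in> pverts G; d \<noteq> v\<rbrakk> \<Longrightarrow> (d, v) \<in> parcs G"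
    and "D \<noteq> {}" and nz: "\<exists>x\<in>pverts G. g x \<noteq> 0"
    and eigen: "\<And>x. x \<in> pverts G \<Longrightarrow> laplacian_op G g x = card D * g x"
  shows "laplacian_eigenvalue (card (pverts G) - 1) G = card D"
proof -
  define vs where "vs = (SOME vs. distinct vs \<and> set vs = pverts G)"
  have "\<exists>vs. distinct vs \<and> set vs = pverts G"
    using finite_distinct_list[OF pair_finite_verts] by blast
  then have "distinct vs \<and> set vs = pverts G" unfolding vs_def by (rule someI_ex)
  then have vs: "distinct vs" "set vs = pverts G" by auto
  let ?L = "laplacian_mat G vs" and ?n = "length vs"
  have cD: "0 < card D" using assms(3) D(1) pair_finite_verts finite_subset card_gt_0_iff by blast
  have cV: "0 < card (pverts G)" using nz pair_finite_verts card_gt_0_iff by blast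
  have "0 < ?n" using nz vs(2) by (cases vs) auto
  moreover have "v = 0\<^sub>v ?n" if v: "v \<in> carrier_vec ?n" "?L *\<^sub>v v = 0\<^sub>v ?n" "(\<Sum>i<?n. v $ i) = 0" for v
  proof (rule ccontr)
    assume nz: "v \<noteq> 0\<^sub>v ?n"
    obtain f where f: "v = vec ?n (\<lambda>i. f (vs ! i))" using vec_eq_function_values[OF vs v(1)] .
    have "?L *\<^sub>v v = 0 \<cdot>\<^sub>v v" using v by auto
    then have "\<forall>x\<in>pverts G. laplacian_op G f x = 0 * f x"
      unfolding f using laplacian_mat_eq_iff[OF vs, of f 0] by blast
    moreover have "(\<Sum>x\<in>pverts G. f x) = 0" using v(3) sum_over_list[OF vs, of f] by (simp add: f)
    moreover have "\<exists>x\<in>pverts G. f x \<noteq> 0" using nz vec_eq_0_iff[OF vs, of f] unfolding f by blast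
    ultimately show False using card_dominating_le_eigenvalue[OF D, of f 0] cD by auto
  qed
  ultimately obtain q where q: "char_poly ?L = [:0, 1:] * q" "poly q 0 \<noteq> 0"
    using char_poly_simple_root_0[OF laplacian_mat_carrier[OF vs] _ sum_column_laplacian_mat[OF vs]]
    by blast
  have "sorted_list_of_multiset (proots (char_poly ?L)) ! 1 = card D"
  proof (rule second_of_sorted_roots[OF q])
    show "poly (char_poly ?L) (card D) = 0"
      unfolding root_char_poly_laplacian_mat_iff[OF vs] using nz eigen by (intro exI[of _ g]) simp
    show "0 < real (card D)" using cD by simp
    fix c assume "poly (char_poly ?L) c = 0" "c \<noteq> 0"
    then obtain f where f: "\<exists>x\<in>pverts G. f x \<noteq> 0" "\<And>x. x \<in> pverts G \<Longrightarrow> laplacian_op G f x = c * f x"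
      unfolding root_char_poly_laplacian_mat_iff[OF vs] by blast
    have "c * (\<Sum>x\<in>pverts G. f x) = 0"
      using sum_laplacian_op[of f] f(2) by (simp add: sum_distrib_left)
    then show "card D \<le> c" using card_dominating_le_eigenvalue[OF D _ f] \<open>c \<noteq> 0\<close> by simp
  qed
  \<comment> \<open>The list ascends while the numbering descends, so this eigenvalue sits at index
    1; the truncated subtraction is harmless because there is a vertex.\<close>
  moreover have "card (pverts G) - (card (pverts G) - 1) = 1" using cV by simp
  ultimately show ?thesis
    by (simp add: laplacian_eigenvalue_def laplacian_spectrum_def vs_def)
qed

text \<open>Let a function be constant on \<open>A\<close> and on \<open>B\<close> and 0 on
  \<open>C\<close>. At a point of \<open>A\<close> or \<open>B\<close> each vertex of
  \<open>C\<close> contributes the function value, and all other terms vanish.\<close>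

lemma second_laplacian_eigenvalue_join:
  assumes V: "pverts G = C \<union> A \<union> B" "C \<inter> A = {}" "C \<inter> B = {}" "A \<inter> B = {}"
    and ne: "C \<noteq> {}" "A \<noteq> {}" "B \<noteq> {}"
    and dom: "\<And>c v. \<lbrakk>c \<in> C; v \<in> pverts G; c \<noteq> v\<rbrakk> \<Longrightarrow> (c, v) \<in> parcs G"
    and sep: "\<And>a b. \<lbrakk>a \<in> A; b \<in> B\<rbrakk> \<Longrightarrow> (a, b) \<notin> parcs G"
  shows "laplacian_eigenvalue (card (pverts G) - 1) G = card C"
proof -
  have fin: "finite A" "finite B" "finite C" using pair_finite_verts V(1) by auto
  \<comment> \<open>The weights make \<open>g\<close> sum to 0, so that its Laplacian vanishes on
    the dominating set \<open>C\<close>.\<close>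
  define g :: "'a \<Rightarrow> real" where
    "g x = (if x \<in> A then real (card B) else if x \<in> B then - real (card A) else 0)" for x
  have gA: "g x = card B" if "x \<in> A" for x using that by (simp add: g_def)
  have gB: "g x = - real (card A)" if "x \<in> B" for x using that V(4) by (auto simp: g_def)
  have gC: "g x = 0" if "x \<in> C" for x using that V by (auto simp: g_def)
  have split: "(\<Sum>x\<in>pverts G. h x) = (\<Sum>x\<in>C. h x) + (\<Sum>x\<in>A. h x) + (\<Sum>x\<in>B. h x)" for h :: "'a \<Rightarrow> real"
    unfolding V(1) using fin V by (simp add: sum.union_disjoint Int_Un_distrib2)
  obtain a where "a \<in> A" using ne by blast
  then have nz: "\<exists>x\<in>pverts G. g x \<noteq> 0"
    using ne V(1) fin gA by (intro bexI[of _ a]) auto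
  have "laplacian_op G g x = card C * g x" if x: "x \<in> pverts G" for x
  proof -
    consider "x \<in> C" | "x \<in> A" | "x \<in> B" using V x by blast
    then show ?thesis
    proof cases
      case 1
      have "(\<Sum>x\<in>pverts G. g x) = 0" by (simp add: split gA gB gC)
      then show ?thesis using laplacian_op_dominating[of x g] dom[OF 1] gC[OF 1] V(1) 1 by simp
    next
      case 2
      have "x \<notin> C" using 2 V by blast
      then have *: "(x, y) \<in> parcs G" if "y \<in> C" for y using that dom[of y x] V(1) 2 arcs_commute by blast
      have "(\<Sum>y\<in>A. if (x, y) \<in> parcs G then g x - g y else 0) = 0"
        using 2 by (intro sum.neutral) (simp add: gA)
      then show ?thesis unfolding laplacian_op_alt split using 2 * sep by (simp add: gA gB gC)
    next
      case 3
      have "x \<notin> C" using 3 V by blast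
      then have *: "(x, y) \<in> parcs G" if "y \<in> C" for y using that dom[of y x] V(1) 3 arcs_commute by blast
      have "(\<Sum>y\<in>B. if (x, y) \<in> parcs G then g x - g y else 0) = 0"
        using 3 by (intro sum.neutral) (simp add: gB)
      moreover have "(x, y) \<notin> parcs G" if "y \<in> A" for y using sep[OF that 3] arcs_commute by blast
      ultimately show ?thesis unfolding laplacian_op_alt split using 3 * by (simp add: gA gB gC)
    qed
  qed
  then show ?thesis
    using second_laplacian_eigenvalue_eq_card_dominating[OF _ dom ne(1) nz] V(1) by blast
qed

text \<open>All vertices dominate, so every function of sum 0 is an eigenfunction for the number of
  vertices; two vertices give a nonzero one.\<close>

lemma second_laplacian_eigenvalue_complete:
  assumes complete: "\<And>u v. \<lbrakk>u \<in> pverts G; v \<in> pverts G; u \<noteq> v\<rbrakk> \<Longrightarrow> (u, v) \<in> parcs G"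
    and two: "2 \<le> card (pverts G)"
  shows "laplacian_eigenvalue (card (pverts G) - 1) G = card (pverts G)"
proof -
  obtain u w where uw: "u \<in> pverts G" "w \<in> pverts G" "u \<noteq> w"
    using two by (auto simp: numeral_2_eq_2 card_le_Suc_iff)
  define g :: "'a \<Rightarrow> real" where "g x = (if x = u then 1 else 0) - (if x = w then 1 else 0)" for x
  have "(\<Sum>x\<in>pverts G. g x) = 0" using uw pair_finite_verts by (simp add: g_def sum_subtractf)
  then have "laplacian_op G g x = card (pverts G) * g x" if "x \<in> pverts G" for x
    using laplacian_op_dominating[OF that complete[OF that]] by simp
  moreover have "\<exists>x\<in>pverts G. g x \<noteq> 0" using uw by (auto simp: g_def intro!: bexI[of _ u])
  moreover have "pverts G \<noteq> {}" using uw by auto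
  ultimately show ?thesis
    using second_laplacian_eigenvalue_eq_card_dominating[OF subset_refl complete] by blast
qed


subsection \<open>Vertex connectivity\<close>

text \<open>Connectedness is defined through the symmetric closure, which changes nothing here
  because the arcs are symmetric already.\<close>

lemma arcs_ends_induced:
  "arcs_ends (with_proj (mk_symmetric (with_proj G \<restriction> U))) = parcs G \<inter> U \<times> U"
  using pair_sym_arcs by (auto simp: mk_symmetric_def symmetric_def sym_def)

lemma connected_induced_dominating:
  assumes d: "d \<in> U" and dom: "\<And>v. \<lbrakk>v \<in> U; d \<noteq> v\<rbrakk> \<Longrightarrow> (d, v) \<in> parcs G"
  shows "connected (with_proj G \<restriction> U)"
proof -
  let ?r = "rtrancl_on U (parcs G \<inter> U \<times> U)"
  have "(d, v) \<in> ?r" if "v \<in> U" for v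
    using d dom[OF that] that by (cases "d = v") (auto intro: rtrancl_on_into_rtrancl_on[of d d])
  moreover have "(v, d) \<in> ?r" if "v \<in> U" for v
    using d dom[OF that] that pair_sym_arcs
    by (cases "d = v") (auto simp: symmetric_def intro: rtrancl_on_into_rtrancl_on[of v v] dest: symD)
  ultimately have "(u, v) \<in> ?r" if "u \<in> U" "v \<in> U" for u v
    using that rtrancl_on_trans by metis
  then show ?thesis
    using d unfolding connected_def strongly_connected_def reachable_def arcs_ends_induced
    by (auto simp: mk_symmetric_def)
qed

text \<open>By induction along it, a walk inside \<open>A \<union> B\<close> that starts in
  \<open>A\<close> stays in \<open>A\<close>.\<close>

lemma not_connected_induced:
  assumes ne: "A \<noteq> {}" "B \<noteq> {}" "A \<inter> B = {}"
    and sep: "\<And>a b. \<lbrakk>a \<in> A; b \<in> B\<rbrakk> \<Longrightarrow> (a, b) \<notin> parcs G"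
  shows "\<not> connected (with_proj G \<restriction> (A \<union> B))"
proof
  assume *: "connected (with_proj G \<restriction> (A \<union> B))"
  obtain a b where ab: "a \<in> A" "b \<in> B" using ne by blast
  then have "(a, b) \<in> rtrancl_on (A \<union> B) (parcs G \<inter> (A \<union> B) \<times> (A \<union> B))"
    using * unfolding connected_def strongly_connected_def reachable_def arcs_ends_induced
    by (simp add: mk_symmetric_def)
  then have "b \<in> A" by (induction rule: rtrancl_on_induct) (use ab sep in auto)
  then show False using ab ne by blast
qed

text \<open>The lower bound for both connectivity computations: a surviving vertex of
  \<open>D\<close> keeps the rest connected, so only the one-vertex case is left.\<close>

lemma vertex_cut_dominating:
  assumes D: "D \<subseteq> pverts G" "\<And>d v. \<lbrakk>d \<in> D; v \<in> pverts G; d \<noteq> v\<rbrakk> \<Longrightarrow> (d, v) \<in> parcs G"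
    and S: "S \<subset> pverts G" "\<not> connected (with_proj G \<restriction> (pverts G - S)) \<or> card (pverts G - S) = 1"
  shows "card D \<le> card S \<or> card S = card (pverts G) - 1"
proof (cases "D \<subseteq> S")
  case True
  then show ?thesis using S(1) pair_finite_verts card_mono finite_subset by blast
next
  case False
  then obtain d where d: "d \<in> D" "d \<in> pverts G - S" using D(1) by blast
  then have "card (pverts G - S) = 1"
    using S(2) connected_induced_dominating[OF d(2)] D(2) by blast
  moreover have "card (pverts G - S) = card (pverts G) - card S" "card S \<le> card (pverts G)"
    using S(1) pair_finite_verts finite_subset[of S "pverts G"]
    by (auto simp: card_Diff_subset intro: card_mono)
  ultimately show ?thesis by linarith
qed

lemma vertex_connectivity_join:
  assumes V: "pverts G = C \<union> A \<union> B" "C \<inter> A = {}" "C \<inter> B = {}" "A \<inter> B = {}"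
    and ne: "A \<noteq> {}" "B \<noteq> {}"
    and dom: "\<And>c v. \<lbrakk>c \<in> C; v \<in> pverts G; c \<noteq> v\<rbrakk> \<Longrightarrow> (c, v) \<in> parcs G"
    and sep: "\<And>a b. \<lbrakk>a \<in> A; b \<in> B\<rbrakk> \<Longrightarrow> (a, b) \<notin> parcs G"
  shows "vertex_connectivity G = card C"
  unfolding vertex_connectivity_def
proof (rule Least_equality)
  have C: "C \<subset> pverts G" using V ne by blast
  have "pverts G - C = A \<union> B" using V(1-3) by blast
  then have "\<not> connected (with_proj G \<restriction> (pverts G - C))" using not_connected_induced[OF ne V(4) sep] by simp
  then show "\<exists>S. S \<subset> pverts G \<and> card S = card C \<and>
      (\<not> connected (with_proj G \<restriction> (pverts G - S)) \<or> card (pverts G - S) = 1)"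
    using C by (intro exI[of _ C]) simp
  fix k assume "\<exists>S. S \<subset> pverts G \<and> card S = k \<and>
      (\<not> connected (with_proj G \<restriction> (pverts G - S)) \<or> card (pverts G - S) = 1)"
  then have "card C \<le> k \<or> k = card (pverts G) - 1"
    using vertex_cut_dominating[OF psubset_imp_subset[OF C] dom] by blast
  \<comment> \<open>\<open>C\<close> is a proper subset, so leaving a single vertex costs at least
    as much as removing \<open>C\<close>.\<close>
  then show "card C \<le> k" using psubset_card_mono[OF pair_finite_verts C] by linarith
qed

lemma vertex_connectivity_complete:
  assumes complete: "\<And>u v. \<lbrakk>u \<in> pverts G; v \<in> pverts G; u \<noteq> v\<rbrakk> \<Longrightarrow> (u, v) \<in> parcs G"
    and ne: "pverts G \<noteq> {}"
  shows "vertex_connectivity G = card (pverts G) - 1"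
  unfolding vertex_connectivity_def
proof (rule Least_equality)
  obtain w where w: "w \<in> pverts G" using ne by blast
  then have "pverts G - (pverts G - {w}) = {w}" by blast
  then show "\<exists>S. S \<subset> pverts G \<and> card S = card (pverts G) - 1 \<and>
      (\<not> connected (with_proj G \<restriction> (pverts G - S)) \<or> card (pverts G - S) = 1)"
    using w pair_finite_verts by (intro exI[of _ "pverts G - {w}"]) auto
  fix k assume "\<exists>S. S \<subset> pverts G \<and> card S = k \<and>
      (\<not> connected (with_proj G \<restriction> (pverts G - S)) \<or> card (pverts G - S) = 1)"
  then have "card (pverts G) \<le> k \<or> k = card (pverts G) - 1"
    using vertex_cut_dominating[OF subset_refl complete] by blast
  then show "card (pverts G) - 1 \<le> k" by linarith
qed

end


subsection \<open>Power graphs of finite p-groups\<close>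

text \<open>In a group, for \<open>d\<close> dividing a nonzero \<open>ord x\<close>, this is the
  only subgroup of order \<open>d\<close> in \<open>generate G {x}\<close>. Being given by an
  equation, it grows with \<open>generate G {x}\<close>.\<close>

definition (in monoid) cyclic_torsion :: "nat \<Rightarrow> 'a \<Rightarrow> 'a set" where
  "cyclic_torsion d x = {y \<in> generate G {x}. y [^] d = \<one>}"

context group
begin

text \<open>With \<open>e = ord x div d\<close>, the power \<open>x [^] m\<close> is killed by
  \<open>d\<close> iff \<open>e * d\<close> divides \<open>m * d\<close>, that is, iff
  \<open>e\<close> divides \<open>m\<close>.\<close>

lemma cyclic_torsion_eq_generate:
  assumes x: "x \<in> carrier G" and "ord x \<noteq> 0" and d: "d dvd ord x"
  shows "cyclic_torsion d x = generate G {x [^] (ord x div d)}"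
proof -
  define e where "e = ord x div d"
  have o: "ord x = e * d" and e: "e dvd ord x" "e \<noteq> 0" and d0: "d \<noteq> 0"
    using d assms(2) by (auto simp: e_def)
  have "ord (x [^] e) \<noteq> 0"
    using ord_pow[OF x e] o e(2) d0 by simp
  then have g: "generate G {x [^] e} = {x [^] (e * k) | k. k \<in> (UNIV :: nat set)}"
    using generate_pow_nat[of "x [^] e"] x by (simp add: nat_pow_pow)
  have "x [^] m \<in> generate G {x [^] e}" if "(x [^] m) [^] d = \<one>" for m :: nat
  proof -
    have "e * d dvd m * d"
      using that pow_eq_id[OF x, of "m * d"] x o by (simp add: nat_pow_pow)
    then have "e dvd m" using d0 by simp
    then show ?thesis unfolding g by auto
  qed
  moreover have "(x [^] (e * k)) [^] d = \<one>" for k :: nat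
    using pow_eq_id[OF x, of "e * k * d"] x o by (simp add: nat_pow_pow)
  ultimately show ?thesis
    unfolding cyclic_torsion_def e_def[symmetric] generate_pow_nat[OF x assms(2)]
    by (auto simp: g)
qed

lemma card_cyclic_torsion:
  assumes x: "x \<in> carrier G" and "ord x \<noteq> 0" and d: "d dvd ord x"
  shows "card (cyclic_torsion d x) = d"
proof -
  define e where "e = ord x div d"
  have o: "ord x = e * d" and e: "e dvd ord x" "e \<noteq> 0"
    using d assms(2) by (auto simp: e_def)
  have "card (cyclic_torsion d x) = ord (x [^] e)"
    unfolding cyclic_torsion_eq_generate[OF assms] e_def[symmetric]
    using generate_pow_card x by simp
  also have "\<dots> = d" using ord_pow[OF x e] o e(2) by simp
  finally show ?thesis .
qed

lemma generate_singleton_mono: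
  assumes "x \<in> carrier G" "y \<in> generate G {x}"
  shows "generate G {y} \<subseteq> generate G {x}"
  using assms generate_is_subgroup[of "{x}"] generate_subgroup_incl[of "{y}"] by simp

text \<open>One set contains the other and both have \<open>d\<close> elements. Applied to adjacent
  vertices of the power graph, this separates the two sides of the cut.\<close>

lemma cyclic_torsion_cong:
  assumes x: "x \<in> carrier G" "ord x \<noteq> 0" and y: "y \<in> generate G {x}" and d: "d dvd ord y"
  shows "cyclic_torsion d y = cyclic_torsion d x"
proof (rule card_subset_eq)
  have yc: "y \<in> carrier G" using generate_in_carrier x y by blast
  obtain m :: nat where "y = x [^] m" using y generate_pow_nat[OF x] by auto
  then have "y [^] ord x = \<one>"
    using x by (metis nat_pow_comm nat_pow_one nat_pow_pow mult.commute pow_ord_eq_1)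
  then have "ord y dvd ord x" using pow_eq_id yc by blast
  then have "d dvd ord x" "ord y \<noteq> 0" using x d by auto
  then have *: "card (cyclic_torsion d x) = d" "card (cyclic_torsion d y) = d"
    using card_cyclic_torsion x yc d by auto
  then show "card (cyclic_torsion d y) = card (cyclic_torsion d x)" by simp
  have "d \<noteq> 0" using \<open>d dvd ord x\<close> x by auto
  then show "finite (cyclic_torsion d x)" using * card_ge_0_finite by force
  show "cyclic_torsion d y \<subseteq> cyclic_torsion d x"
    using generate_singleton_mono[OF x(1) y] by (auto simp: cyclic_torsion_def)
qed

lemma cyclic_group_iff_generate: "cyclic_group G \<longleftrightarrow> (\<exists>x\<in>carrier G. carrier G = generate G {x})"
proof -
  have "range (\<lambda>n::int. x [^] n) = generate G {x}" if "x \<in> carrier G" for x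
    using generate_pow[OF that] by auto
  then show ?thesis unfolding cyclic_group by auto
qed

lemma mem_cyclic_torsion_self:
  assumes "x \<in> carrier G" "ord x dvd d"
  shows "x \<in> cyclic_torsion d x"
  using assms by (auto simp: cyclic_torsion_def pow_eq_id intro: generate.incl)

end

section \<open>Finite p-groups and adjacency in their power graphs\<close>

locale finite_p_group = group G for G :: "('a, 'b) monoid_scheme" (structure) +
  fixes p :: nat
  assumes prime_p: "Factorial_Ring.prime p"
    and finite_carrier: "finite (carrier G)"
    and ord_prime_power: "x \<in> carrier G \<Longrightarrow> \<exists>k. ord x = p ^ k"
begin

lemma ord_nonzero: "x \<in> carrier G \<Longrightarrow> ord x \<noteq> 0"
  using ord_ge_1[OF finite_carrier] by fastforce

lemma cyclic_torsion_subset: "x \<in> carrier G \<Longrightarrow> cyclic_torsion d x \<subseteq> carrier G"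
  using generate_in_carrier[of "{x}"] by (auto simp: cyclic_torsion_def)

lemma prime_power_dvd_ord_cases:
  assumes "x \<in> carrier G"
  shows "(\<exists>j<k. ord x = p ^ j) \<or> p ^ k dvd ord x"
proof -
  obtain j where "ord x = p ^ j" using ord_prime_power[OF assms] by blast
  then show ?thesis using le_imp_power_dvd[of k j p] by (cases "j < k") auto
qed

text \<open>Both orders are powers of \<open>p\<close>, so one divides the other; the element of
  smaller order then lies in a torsion subgroup that \<open>x\<close> and the other element
  share.\<close>

lemma generate_comparable:
  assumes x: "x \<in> carrier G" and u: "u \<in> generate G {x}" and v: "v \<in> generate G {x}"
  shows "u \<in> generate G {v} \<or> v \<in> generate G {u}"
proof -
  have c: "u \<in> carrier G" "v \<in> carrier G" using generate_in_carrier x u v by blast+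
  have *: "y \<in> generate G {z}"
    if y: "y \<in> generate G {x}" "y \<in> carrier G" and z: "z \<in> generate G {x}" and d: "ord y dvd ord z"
    for y z
  proof -
    have "y \<in> cyclic_torsion (ord y) y" using mem_cyclic_torsion_self[OF y(2) dvd_refl] .
    also have "\<dots> = cyclic_torsion (ord y) x"
      by (rule cyclic_torsion_cong[OF x ord_nonzero[OF x] y(1) dvd_refl])
    also have "\<dots> = cyclic_torsion (ord y) z"
      by (rule cyclic_torsion_cong[OF x ord_nonzero[OF x] z d, symmetric])
    finally show ?thesis by (simp add: cyclic_torsion_def)
  qed
  obtain i j where "ord u = p ^ i" "ord v = p ^ j" using ord_prime_power c by blast
  then have "ord u dvd ord v \<or> ord v dvd ord u"
    by (metis le_imp_power_dvd nat_le_linear)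
  then show ?thesis using * u v c by blast
qed

text \<open>Adding \<open>ord x\<close> makes an exponent positive without changing the power.
  Adjacency thereby becomes membership in a cyclic subgroup.\<close>

lemma generate_singleton_eq_positive_powers:
  assumes x: "x \<in> carrier G"
  shows "generate G {x} = {x [^] m | m::nat. 0 < m}"
proof -
  have "x [^] k = x [^] (k + ord x)" for k :: nat
    using x by (simp add: nat_pow_mult[symmetric])
  moreover have "0 < k + ord x" for k :: nat using ord_nonzero[OF x] by simp
  ultimately show ?thesis unfolding generate_pow_nat[OF x ord_nonzero[OF x]] by blast
qed

lemma parcs_power_graph_iff:
  "(u, v) \<in> parcs (power_graph G) \<longleftrightarrow> u \<in> carrier G \<and> v \<in> carrier G \<and> u \<noteq> v \<and>
     (u \<in> generate G {v} \<or> v \<in> generate G {u})"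
  by (auto simp: power_graph_def generate_singleton_eq_positive_powers)

lemma cyclic_group_complete:
  assumes "cyclic_group G" "u \<in> carrier G" "v \<in> carrier G" "u \<noteq> v"
  shows "(u, v) \<in> parcs (power_graph G)"
proof -
  obtain x where x: "x \<in> carrier G" "carrier G = generate G {x}"
    using assms(1) cyclic_group_iff_generate by blast
  then show ?thesis using generate_comparable[OF x(1), of u v] assms
    unfolding parcs_power_graph_iff by auto
qed

text \<open>An element \<open>x\<close> of maximal order generates the group: \<open>ord y\<close>
  divides \<open>ord x\<close>, so \<open>y\<close> lies in a torsion subgroup that \<open>x\<close>
  and \<open>y\<close> share.\<close>

lemma cyclic_group_if_cyclic_torsion_const:
  assumes *: "\<And>k x y. \<lbrakk>x \<in> carrier G; y \<in> carrier G; p ^ k dvd ord x; p ^ k dvd ord y\<rbrakk>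
    \<Longrightarrow> cyclic_torsion (p ^ k) x = cyclic_torsion (p ^ k) y"
  shows "cyclic_group G"
proof -
  have "Max (ord ` carrier G) \<in> ord ` carrier G" using finite_carrier by (intro Max_in) auto
  then obtain x where x: "x \<in> carrier G" and max: "ord x = Max (ord ` carrier G)" by auto
  have "y \<in> generate G {x}" if y: "y \<in> carrier G" for y
  proof -
    have le: "ord y \<le> ord x" using y max finite_carrier by simp
    obtain i j where ij: "ord x = p ^ i" "ord y = p ^ j" using ord_prime_power x y by blast
    then have "j \<le> i" using le prime_gt_1_nat[OF prime_p] by simp
    then have "cyclic_torsion (p ^ j) y = cyclic_torsion (p ^ j) x"
      using *[OF y x, of j] ij by (simp add: le_imp_power_dvd)
    then show ?thesis
      using mem_cyclic_torsion_self[OF y, of "p ^ j"] ij by (auto simp: cyclic_torsion_def)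
  qed
  then have "carrier G = generate G {x}" using generate_in_carrier x by blast
  then show ?thesis using x cyclic_group_iff_generate by blast
qed

text \<open>
  An element outside of \<open>C\<close> shares its cyclic subgroup of order \<open>p * card C\<close> with all its neighbours
  outside of \<open>C\<close>.
\<close>
lemma noncyclic_power_graph_decomposition:
  assumes "\<not> cyclic_group G"
  obtains C A B where "carrier G = C \<union> A \<union> B" "C \<inter> A = {}" "C \<inter> B = {}" "A \<inter> B = {}"
    "C \<noteq> {}" "A \<noteq> {}" "B \<noteq> {}"
    "\<And>c v. \<lbrakk>c \<in> C; v \<in> carrier G; c \<noteq> v\<rbrakk> \<Longrightarrow> (c, v) \<in> parcs (power_graph G)"
    "\<And>a b. \<lbrakk>a \<in> A; b \<in> B\<rbrakk> \<Longrightarrow> (a, b) \<notin> parcs (power_graph G)"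
proof -
  \<comment> \<open>\<open>Q k\<close> says that there is at most one cyclic subgroup of order
    \<open>p ^ k\<close>; \<open>m\<close> will be the least exponent where this fails.\<close>
  define Q where "Q k \<longleftrightarrow> (\<forall>x\<in>carrier G. \<forall>y\<in>carrier G. p ^ k dvd ord x \<longrightarrow> p ^ k dvd ord y \<longrightarrow>
    cyclic_torsion (p ^ k) x = cyclic_torsion (p ^ k) y)" for k
  obtain k' where "\<not> Q k'"
    using assms cyclic_group_if_cyclic_torsion_const unfolding Q_def by blast
  then obtain m where m: "\<not> Q m" "\<And>i. i < m \<Longrightarrow> Q i"
    using exists_least_iff[of "\<lambda>k. \<not> Q k"] by blast
  \<comment> \<open>Only the trivial subgroup has order 1, so \<open>m\<close> is a
    successor.\<close>
  have "Q 0"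
  proof -
    have "cyclic_torsion 1 x = {\<one>}" if "x \<in> carrier G" for x
      using that generate_in_carrier[of "{x}"] by (auto simp: cyclic_torsion_def intro: generate.one)
    then show ?thesis unfolding Q_def by auto
  qed
  then obtain k where k: "m = Suc k" using m(1) by (cases m) auto
  have Q: "cyclic_torsion (p ^ i) x = cyclic_torsion (p ^ i) y"
    if "i \<le> k" "x \<in> carrier G" "y \<in> carrier G" "p ^ i dvd ord x" "p ^ i dvd ord y" for i x y
  proof -
    have "Q i" using m(2)[of i] that(1) k by simp
    then show ?thesis using that unfolding Q_def by blast
  qed
  obtain x0 y0 where x0: "x0 \<in> carrier G" "p ^ m dvd ord x0"
    and y0: "y0 \<in> carrier G" "p ^ m dvd ord y0"
    and ne: "cyclic_torsion (p ^ m) x0 \<noteq> cyclic_torsion (p ^ m) y0"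
    using m(1) unfolding Q_def by blast
  have dvd_x0: "p ^ i dvd ord x0" if "i \<le> m" for i
    using x0(2) le_imp_power_dvd[OF that, of p] dvd_trans by blast
  \<comment> \<open>By \<open>Q k\<close> another element of order divisible by \<open>p ^ k\<close>
    would give the same \<open>C\<close>.\<close>
  define C where "C = cyclic_torsion (p ^ k) x0"
  \<comment> \<open>The sides are told apart by their subgroup of order \<open>p ^ m\<close>;
    \<open>x0\<close> will lie in \<open>A\<close> and \<open>y0\<close> in
    \<open>B\<close>.\<close>
  define A where "A = {z \<in> carrier G - C. cyclic_torsion (p ^ m) z = cyclic_torsion (p ^ m) x0}"
  define B where "B = carrier G - C - A"
  have C: "C \<subseteq> carrier G" unfolding C_def by (rule cyclic_torsion_subset[OF x0(1)])
  \<comment> \<open>Uniqueness at the exponent \<open>j\<close> moves \<open>z\<close> into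
    \<open>generate G {x0}\<close>. With \<open>large\<close> and \<open>notC\<close> this shows
    that the elements outside \<open>C\<close> are exactly those of order divisible by
    \<open>p ^ m\<close>.\<close>
  have in_C: "z \<in> C" if z: "z \<in> carrier G" "ord z = p ^ j" "j \<le> k" for z j
  proof -
    have "z \<in> cyclic_torsion (p ^ j) z" using mem_cyclic_torsion_self z by simp
    also have "\<dots> = cyclic_torsion (p ^ j) x0"
      by (rule Q) (use z x0(1) dvd_x0[of j] k in auto)
    finally have "z \<in> generate G {x0}" "ord z dvd p ^ j"
      using z by (auto simp: cyclic_torsion_def)
    then have "ord z dvd p ^ k" using z le_imp_power_dvd[of j k p] by simp
    then show ?thesis using \<open>z \<in> generate G {x0}\<close> pow_eq_id[OF z(1)]
      by (auto simp: C_def cyclic_torsion_def)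
  qed
  have large: "p ^ m dvd ord z" if "z \<in> carrier G" "z \<notin> C" for z
    using prime_power_dvd_ord_cases[OF that(1), of m] in_C[OF that(1)] that(2) k
    by (metis less_Suc_eq_le)
  have notC: "z \<notin> C" if "z \<in> carrier G" "p ^ m dvd ord z" for z
  proof
    assume "z \<in> C"
    then have "ord z dvd p ^ k" using pow_eq_id[OF that(1)] by (auto simp: C_def cyclic_torsion_def)
    then have "p ^ m dvd p ^ k" using that dvd_trans by blast
    then show False using k prime_gt_1_nat[OF prime_p] by (simp add: power_dvd_imp_le)
  qed
  show thesis
  proof
    show "carrier G = C \<union> A \<union> B" using C by (auto simp: A_def B_def)
    show "C \<inter> A = {}" "C \<inter> B = {}" "A \<inter> B = {}" by (auto simp: A_def B_def)
    show "C \<noteq> {}" using in_C[OF one_closed, of 0] by auto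
    show "A \<noteq> {}" using x0 notC[OF x0] by (auto simp: A_def)
    show "B \<noteq> {}" using y0 notC[OF y0] ne by (auto simp: A_def B_def)
    show "(c, v) \<in> parcs (power_graph G)" if c: "c \<in> C" and v: "v \<in> carrier G" and "c \<noteq> v" for c v
    proof -
      \<comment> \<open>Inside \<open>C\<close> both elements lie in \<open>generate G {x0}\<close>;
        for \<open>v\<close> outside, \<open>Q k\<close> identifies \<open>C\<close> with a torsion
        subgroup of \<open>v\<close>.\<close>
      have "c \<in> generate G {v} \<or> v \<in> generate G {c}"
      proof (cases "v \<in> C")
        case True
        then show ?thesis using c generate_comparable[OF x0(1)] by (simp add: C_def cyclic_torsion_def)
      next
        case False
        then have "p ^ k dvd ord v"
          using prime_power_dvd_ord_cases[OF v, of k] in_C[OF v] by (metis less_imp_le)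
        then have "cyclic_torsion (p ^ k) v = C"
          unfolding C_def by (intro Q) (use v x0(1) dvd_x0[of k] k in auto)
        then show ?thesis using c by (auto simp: cyclic_torsion_def)
      qed
      then show ?thesis using C c v \<open>c \<noteq> v\<close> by (auto simp: parcs_power_graph_iff)
    qed
    show "(a, b) \<notin> parcs (power_graph G)" if a: "a \<in> A" and b: "b \<in> B" for a b
    proof
      assume arc: "(a, b) \<in> parcs (power_graph G)"
      have c: "a \<in> carrier G" "b \<in> carrier G" "p ^ m dvd ord a" "p ^ m dvd ord b"
        using a b large by (auto simp: A_def B_def)
      have "a \<in> generate G {b} \<or> b \<in> generate G {a}" using arc by (simp add: parcs_power_graph_iff)
      then have "cyclic_torsion (p ^ m) a = cyclic_torsion (p ^ m) b"
        using cyclic_torsion_cong[OF c(1) ord_nonzero[OF c(1)] _ c(4)]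
          cyclic_torsion_cong[OF c(2) ord_nonzero[OF c(2)] _ c(3)] by metis
      then show False using a b by (auto simp: A_def B_def)
    qed
  qed
qed

lemma pair_graph_power_graph: "pair_graph (power_graph G)"
proof
  have "parcs (power_graph G) \<subseteq> carrier G \<times> carrier G" by (auto simp: power_graph_def)
  then show "finite (parcs (power_graph G))" using finite_carrier finite_subset by blast
qed (auto simp: power_graph_def finite_carrier symmetric_def sym_def)

end

theorem theorem3p15:
  fixes G :: "('a, 'b) monoid_scheme" and p n :: nat
  assumes "Factorial_Ring.prime p"
    and "p_group p G"
    and "finite (carrier G)"
    and "Coset.order G = n"
  shows "real (vertex_connectivity (power_graph G)) = laplacian_eigenvalue (n - 1) (power_graph G)
    \<longleftrightarrow> \<not> cyclic_group G"
proof -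
  interpret G: group G using assms(2) by (simp add: p_group_def)
  interpret G: finite_p_group G p
    by unfold_locales (use assms in \<open>auto simp: p_group_def\<close>)
  interpret \<Gamma>: pair_graph "power_graph G" by (rule G.pair_graph_power_graph)
  have V: "pverts (power_graph G) = carrier G" by (simp add: power_graph_def)
  have n: "n = card (carrier G)" using assms(4) by (simp add: Coset.order_def)
  \<comment> \<open>The complete graph of the cyclic case needs two vertices to carry a nonzero
    function of sum 0.\<close>
  have "card (carrier G) \<noteq> 1"
  proof
    assume "card (carrier G) = 1"
    then obtain x where "carrier G = {x}" by (rule card_1_singletonE)
    then show False using assms(2) G.one_closed by (simp add: p_group_def)
  qed
  moreover have "0 < card (carrier G)" using assms(3) G.one_closed card_gt_0_iff by blast
  ultimately have two: "2 \<le> n" unfolding n by linarith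
  show ?thesis
  proof (cases "cyclic_group G")
    case True
    have "vertex_connectivity (power_graph G) = n - 1"
      using \<Gamma>.vertex_connectivity_complete G.cyclic_group_complete[OF True] G.one_closed
      unfolding V n by blast
    moreover have "laplacian_eigenvalue (n - 1) (power_graph G) = n"
      using \<Gamma>.second_laplacian_eigenvalue_complete G.cyclic_group_complete[OF True] two
      unfolding V n by blast
    ultimately show ?thesis using True two by simp
  next
    case False
    obtain C A B where dec: "carrier G = C \<union> A \<union> B" "C \<inter> A = {}" "C \<inter> B = {}" "A \<inter> B = {}"
      "C \<noteq> {}" "A \<noteq> {}" "B \<noteq> {}"
      and dom: "\<And>c v. \<lbrakk>c \<in> C; v \<in> carrier G; c \<noteq> v\<rbrakk> \<Longrightarrow> (c, v) \<in> parcs (power_graph G)"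
      and sep: "\<And>a b. \<lbrakk>a \<in> A; b \<in> B\<rbrakk> \<Longrightarrow> (a, b) \<notin> parcs (power_graph G)"
      by (rule G.noncyclic_power_graph_decomposition[OF False]) blast
    have "vertex_connectivity (power_graph G) = card C"
      by (rule \<Gamma>.vertex_connectivity_join[unfolded V, OF dec(1-4,6,7) dom sep])
    moreover have "laplacian_eigenvalue (n - 1) (power_graph G) = card C"
      unfolding n by (rule \<Gamma>.second_laplacian_eigenvalue_join[unfolded V, OF dec dom sep])
    ultimately show ?thesis using False by simp
  qed
qed

end
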